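(* Let $q$ be a prime power and let $r>h\ge 1$ be integers. Then for all sufficiently large integers $s$ (depending on $q,r,h$) the number $n_q(r,h;s)$ attains the Griesmer upper bound, i.e. $n_q(r,h;s)$ equals the largest integer $n$ such that $$g_q\!\left(r,q^{h-1}\cdot(n-s)\right)\le [h]_q\cdot n .$$
   Context: Notation: $[i]_q=\frac{q^i-1}{q-1}$, and for positive integers $k,d$ let $g_q(k,d)=\sum_{i=0}^{k-1}\left\lceil d/q^i\right\rceil$. $\mathrm{PG}(r-1,q)$ denotes the lattice of subspaces of $\mathbb{F}_q^r$; dimensions are vector space dimensions, and hyperplanes are the $(r-1)$-dimensional subspaces. A projective $h-(n,r,s)_q$ system is a multiset $\mathcal{S}$ of $n$ subspaces of $\mathrm{PG}(r-1,q)$ of dimension at most $h$ such that each hyperplane contains at most $s$ elements of $\mathcal{S}$ (counted with multiplicity) and some hyperplane contains exactly $s$ elements of $\mathcal{S}$. $n_q(r,h;s)$ denotes the maximum $n$ such that a projective $h-(n,r,s)_q$ system exists. The Griesmer upper bound for $n_q(r,h;s)$ is the largest integer $n$ with $g_q(r,q^{h-1}(n-s))\le [h]_q n$; it is always an upper bound for $n_q(r,h;s)$. *)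

theory Defs
  imports "HOL-Analysis.Analysis" "HOL-Library.Multiset"
begin

definition q_number :: "nat \<Rightarrow> nat \<Rightarrow> real" where
  "q_number q i = (real q ^ i - 1) / (real q - 1)"

text \<open>
  The argument \<open>d\<close> is an integer, so that \<open>d = q^(h-1) * (n - s)\<close> is not subject to
  truncated subtraction. For \<open>d \<le> 0\<close> the same formula is used; its value is then at most 0.
\<close>

definition griesmer_sum :: "nat \<Rightarrow> nat \<Rightarrow> int \<Rightarrow> int" where
  "griesmer_sum q k d = (\<Sum>i<k. \<lceil>real_of_int d / real q ^ i\<rceil>)"

definition griesmer_condition :: "nat \<Rightarrow> nat \<Rightarrow> nat \<Rightarrow> nat \<Rightarrow> int \<Rightarrow> bool" where
  "griesmer_condition q r h s n \<longleftrightarrow>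
     real_of_int (griesmer_sum q r (int q ^ (h - 1) * (n - int s))) \<le> q_number q h * real_of_int n"

text \<open>
  The lattice \<open>PG(r-1,q)\<close> consists of the \<open>'a\<close>-linear subspaces of \<open>'a ^ 'r\<close>, where
  \<open>CARD('a) = q\<close> and \<open>CARD('r) = r\<close>. Note that \<open>vec.subspace\<close> and \<open>vec.dim\<close> refer to scalar
  multiplication by field elements, unlike \<open>subspace\<close> and \<open>dim\<close>.
\<close>

definition hyperplane :: "('a::field ^ 'r) set \<Rightarrow> bool" where
  "hyperplane H \<longleftrightarrow> vec.subspace H \<and> vec.dim H = CARD('r) - 1"

definition num_contained :: "('a::field ^ 'r) set multiset \<Rightarrow> ('a ^ 'r) set \<Rightarrow> nat" where
  "num_contained S H = size {#U \<in># S. U \<subseteq> H#}"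

text \<open>
  As in the usual definition, elements of dimension less than \<open>h\<close> are allowed (the zero
  subspace included).
\<close>

definition projective_system ::
    "nat \<Rightarrow> nat \<Rightarrow> nat \<Rightarrow> ('a::field ^ 'r) set multiset \<Rightarrow> bool" where
  "projective_system h n s S \<longleftrightarrow>
     size S = n \<and>
     (\<forall>U \<in># S. vec.subspace U \<and> vec.dim U \<le> h) \<and>
     (\<forall>H. hyperplane H \<longrightarrow> num_contained S H \<le> s) \<and>
     (\<exists>H. hyperplane H \<and> num_contained S H = s)"

text \<open>
  The number \<open>n_q(r,h;s)\<close>, with \<open>q\<close> and \<open>r\<close> given by the field type and the index type.
  The set below is finite and nonempty whenever \<open>h < r\<close>, as shown at the end of the theory, so
  that \<open>Max\<close> is meaningful.
\<close>

definition max_system_size ::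
    "'a::{field,finite} itself \<Rightarrow> 'r::finite itself \<Rightarrow> nat \<Rightarrow> nat \<Rightarrow> nat" where
  "max_system_size _ _ h s = Max {n. \<exists>S :: ('a ^ 'r) set multiset. projective_system h n s S}"

lemma subspace_in_hyperplane:
  fixes U :: "('a::field ^ 'r) set"
  assumes "vec.subspace U" "vec.dim U < CARD('r)"
  shows "\<exists>H. hyperplane H \<and> U \<subseteq> H"
proof -
  obtain B where B: "B \<subseteq> U" "vec.independent B" "U \<subseteq> vec.span B" "card B = vec.dim U"
    using vec.basis_exists by blast
  obtain C where C: "B \<subseteq> C" "vec.independent C" "UNIV \<subseteq> vec.span C"
    using vec.maximal_independent_subset_extend[OF subset_UNIV B(2)] by metis
  have cardC: "card C = CARD('r)"
    using vec.dim_span_eq_card_independent[OF C(2)] vec_dim_card[where 'a='a and 'n='r] C(3)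
    by (simp only: top.extremum_unique)
  have "B \<noteq> C" using B(4) cardC assms(2) by auto
  then obtain b where b: "b \<in> C" "b \<notin> B" using C(1) by auto
  have ind: "vec.independent (C - {b})"
    using C(2) by (meson Diff_subset vec.independent_mono)
  have "hyperplane (vec.span (C - {b}))"
    unfolding hyperplane_def
    by (simp only: vec.subspace_span vec.dim_span_eq_card_independent[OF ind]
          card_Diff_singleton[OF b(1)] cardC simp_thms)
  moreover have "U \<subseteq> vec.span (C - {b})"
    using B(3) vec.span_mono[of B "C - {b}"] b(2) C(1) by blast
  ultimately show ?thesis by blast
qed

lemma system_sizes_finite:
  assumes "h < CARD('r::finite)"
  shows "finite {n. \<exists>S :: ('a::{field,finite} ^ 'r) set multiset. projective_system h n s S}"
proof -
  let ?N = "\<Sum>H | hyperplane (H :: ('a ^ 'r) set). s"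
  have "n \<le> ?N" if "projective_system h n s S" for n and S :: "('a ^ 'r) set multiset"
  proof -
    have bound: "num_contained S H \<le> s" if "hyperplane H" for H
      using that \<open>projective_system h n s S\<close> by (auto simp: projective_system_def)
    have "\<forall>U \<in># S. \<exists>H. hyperplane H \<and> U \<subseteq> H"
      using that assms by (auto simp: projective_system_def intro!: subspace_in_hyperplane)
    then have "size S \<le> (\<Sum>H | hyperplane H. num_contained S H)"
    proof (induction S)
      case empty
      then show ?case by simp
    next
      case (add U S)
      then obtain H0 where H0: "hyperplane H0" "U \<subseteq> H0" by auto
      have "num_contained (add_mset U S) H = num_contained S H + (if U \<subseteq> H then 1 else 0)" for H
        by (simp add: num_contained_def)
      then have "(\<Sum>H | hyperplane H. num_contained (add_mset U S) H) =
          (\<Sum>H | hyperplane H. num_contained S H) + (\<Sum>H | hyperplane H. if U \<subseteq> H then 1 else 0)"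
        by (simp add: sum.distrib)
      moreover have "(1::nat) \<le> (\<Sum>H | hyperplane H. if U \<subseteq> H then 1 else 0)"
        using member_le_sum[of H0 "{H. hyperplane H}" "\<lambda>H. if U \<subseteq> H then 1 else (0::nat)"] H0
        by simp
      ultimately show ?case using add by simp
    qed
    also have "\<dots> \<le> ?N" by (intro sum_mono) (use bound in auto)
    finally show ?thesis using that by (simp add: projective_system_def)
  qed
  then have "{n. \<exists>S :: ('a ^ 'r) set multiset. projective_system h n s S} \<subseteq> {..?N}" by auto
  then show ?thesis using finite_subset by blast
qed

lemma system_sizes_nonempty:
  "{n. \<exists>S :: ('a::{field,finite} ^ 'r) set multiset. projective_system h n s S} \<noteq> {}"
proof -
  obtain H :: "('a ^ 'r) set" where H: "hyperplane H"
    using subspace_in_hyperplane[of "{0 :: 'a ^ 'r}"] by (auto simp: vec.subspace_0)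
  have *: "{0} \<subseteq> H'" if "hyperplane H'" for H' :: "('a ^ 'r) set"
    using that by (auto simp: hyperplane_def vec.subspace_0)
  have num: "num_contained (replicate_mset s {0}) H' = s" if "hyperplane H'" for H' :: "('a ^ 'r) set"
    using *[OF that] by (induction s) (simp_all add: num_contained_def)
  have "projective_system h s s (replicate_mset s {0 :: 'a ^ 'r})"
    using H num by (auto simp: projective_system_def)
  then show ?thesis by blast
qed

end

theory Submission
  imports Defs
begin

text \<open>
  Write \<open>[i] = 1 + q + \<dots> + q^(i-1)\<close>, \<open>k = r - h\<close> and \<open>t = n - s\<close>. The Griesmer condition amounts to
  \<open>\<lceil>t/q\<rceil> + \<dots> + \<lceil>t/q^k\<rceil> \<le> [h] s\<close>. Its necessity is the Griesmer bound for the multiset of points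
  covered by the subspaces.

  For sufficiency, fix \<open>A\<close> of dimension \<open>h - 1\<close> and subspaces \<open>E j \<supseteq> A\<close> of dimension \<open>h + j\<close>. Signed
  combinations of the sums over all \<open>h\<close>-subspaces \<open>U\<close> with \<open>A \<subseteq> U \<subseteq> E j\<close>, or with \<open>U \<subseteq> E 1\<close>, give integer
  weights on the \<open>h\<close>-subspaces of total weight \<open>n\<close> for which the \<open>h\<close>-subspaces inside any hyperplane
  weigh at most \<open>s\<close>. The \<open>h\<close>-subspaces counted with the number of their complete flags satisfy the
  Griesmer condition with equality after scaling, so adding them many times makes the weights
  nonnegative and shifts \<open>(s, n)\<close> along a lattice direction preserving the condition. Modulo this
  shift only finitely many pairs \<open>(s, n)\<close> matter.
\<close>

section \<open>Subspaces over a finite field\<close>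

text \<open>Integer form of \<open>q_number\<close>, free of division. It is also the number of
  points of an \<open>i\<close>-dimensional subspace.\<close>

definition gauss_int :: "nat \<Rightarrow> nat \<Rightarrow> int" where
  "gauss_int q i = (\<Sum>j<i. int q ^ j)"

lemma gauss_int_0 [simp]: "gauss_int q 0 = 0"
  by (simp add: gauss_int_def)

lemma gauss_int_Suc: "gauss_int q (Suc i) = gauss_int q i + int q ^ i"
  by (simp add: gauss_int_def)

lemma gauss_int_Suc': "gauss_int q (Suc i) = 1 + int q * gauss_int q i"
proof (induction i)
  case (Suc i)
  have "gauss_int q (Suc (Suc i)) = gauss_int q (Suc i) + int q * int q ^ i"
    by (simp add: gauss_int_Suc)
  also have "\<dots> = 1 + int q * (gauss_int q i + int q ^ i)"
    by (simp add: Suc.IH distrib_left)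
  also have "gauss_int q i + int q ^ i = gauss_int q (Suc i)"
    by (simp add: gauss_int_Suc)
  finally show ?case .
qed (simp add: gauss_int_def)

lemma gauss_int_add: "gauss_int q (i + j) = gauss_int q i + int q ^ i * gauss_int q j"
  by (induction j) (auto simp: gauss_int_Suc algebra_simps power_add)

lemma gauss_int_mult: "(int q - 1) * gauss_int q i = int q ^ i - 1"
  by (induction i) (auto simp: gauss_int_Suc algebra_simps)

lemma gauss_int_nonneg [simp]: "0 \<le> gauss_int q i"
  by (simp add: gauss_int_def sum_nonneg)

lemma gauss_int_pos: "0 < i \<Longrightarrow> 0 < gauss_int q i"
  by (cases i) (auto simp: gauss_int_Suc' add_pos_nonneg)

lemma card_field_ge_2: "2 \<le> CARD('a::{field,finite})"
  using card_mono[of "UNIV :: 'a set" "{0, 1}"] by simp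

lemma card_vec_span:
  fixes B :: "('a::{field,finite} ^ 'r) set"
  assumes "vec.independent B"
  shows "card (vec.span B) = CARD('a) ^ card B"
proof -
  have "finite B" by simp
  then show ?thesis using assms
  proof (induction B)
    case empty
    then show ?case by simp
  next
    case (insert b B)
    have b: "b \<notin> vec.span B" and ind: "vec.independent B"
      using insert.prems insert.hyps by (auto simp: vec.independent_insert split: if_splits)
    let ?f = "\<lambda>(c, x). c *s b + x :: 'a ^ 'r"
    have "vec.span (insert b B) = ?f ` (UNIV \<times> vec.span B)"
    proof (intro equalityI subsetI)
      fix x assume "x \<in> vec.span (insert b B)"
      then obtain c where "x - c *s b \<in> vec.span B"
        using insert.hyps(2) by (auto simp: vec.span_insert)
      then show "x \<in> ?f ` (UNIV \<times> vec.span B)"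
        by (intro image_eqI[of _ _ "(c, x - c *s b)"]) auto
    next
      fix x assume "x \<in> ?f ` (UNIV \<times> vec.span B)"
      then obtain c y where "x = c *s b + y" "y \<in> vec.span B" by auto
      then have "x - c *s b \<in> vec.span B" by simp
      then show "x \<in> vec.span (insert b B)"
        by (auto simp: vec.span_insert)
    qed
    moreover have "inj_on ?f (UNIV \<times> vec.span B)"
    proof (rule inj_onI, clarify)
      fix c x d y assume x: "x \<in> vec.span B" and y: "y \<in> vec.span B"
        and eq: "c *s b + x = d *s b + y"
      have "(c - d) *s b = y - x" using eq by (simp add: vec.scale_left_diff_distrib algebra_simps)
      then have "(c - d) *s b \<in> vec.span B" using x y by (simp add: vec.span_diff)
      \<comment> \<open>Otherwise dividing by \<open>c - d\<close> would put \<open>b\<close> into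
        the old span.\<close>
      then have "c = d"
        using b by (metis eq_iff_diff_eq_0 left_inverse vec.scale_one vec.scale_scale vec.span_scale)
      then show "c = d \<and> x = y" using eq by simp
    qed
    ultimately show ?case
      using insert ind by (simp add: card_image card_cartesian_product)
  qed
qed

lemma card_vec_subspace:
  fixes U :: "('a::{field,finite} ^ 'r) set"
  assumes "vec.subspace U"
  shows "card U = CARD('a) ^ vec.dim U"
proof -
  obtain B where B: "B \<subseteq> U" "vec.independent B" "U \<subseteq> vec.span B" "card B = vec.dim U"
    using vec.basis_exists by blast
  then have "vec.span B = U" using assms by (metis subset_antisym vec.span_minimal)
  then show ?thesis using card_vec_span[OF B(2)] B(4) by simp
qed

lemma vec_dim_less:
  fixes U W :: "('a::field ^ 'r) set"
  assumes "vec.subspace U" "vec.subspace W" "U \<subset> W"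
  shows "vec.dim U < vec.dim W"
  using assms vec.dim_psubset[of U W] by (metis vec.span_eq_iff)

lemma subspace_eqI:
  fixes U W :: "('a::field ^ 'r) set"
  assumes "vec.subspace U" "vec.subspace W" "U \<subseteq> W" "vec.dim W \<le> vec.dim U"
  shows "U = W"
  using vec_dim_less[OF assms(1,2)] assms(3,4) by auto

lemma vec_dim_insert:
  fixes A :: "('a::field ^ 'r) set"
  assumes "vec.subspace A" "v \<notin> A"
  shows "vec.dim (vec.span (insert v A)) = vec.dim A + 1"
  using assms by (metis vec.dim_insert vec.dim_span vec.span_eq_iff)

lemma subspace_of_dim_between:
  fixes A W :: "('a::field ^ 'r) set"
  assumes "vec.subspace A" "vec.subspace W" "A \<subseteq> W" "vec.dim A \<le> d" "d \<le> vec.dim W"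
  shows "\<exists>E. vec.subspace E \<and> A \<subseteq> E \<and> E \<subseteq> W \<and> vec.dim E = d"
  using assms(4,5)
proof (induction d rule: dec_induct)
  case base
  then show ?case using assms by blast
next
  case (step d)
  then obtain E where E: "vec.subspace E" "A \<subseteq> E" "E \<subseteq> W" "vec.dim E = d" by auto
  then have "E \<noteq> W" using step by auto
  then obtain v where v: "v \<in> W" "v \<notin> E" using E by blast
  let ?E = "vec.span (insert v E)"
  have "?E \<subseteq> W" using v E assms by (intro vec.span_minimal) auto
  moreover have "A \<subseteq> ?E" using E(2) vec.span_superset[of "insert v E"] by blast
  ultimately show ?case using vec_dim_insert[OF E(1) v(2)] E(4) by auto
qed

text \<open>For subspaces \<open>A\<close> \<subseteq> \<open>W\<close> these are the points of the
  quotient \<open>W / A\<close>, represented by their preimages in \<open>W\<close>.\<close>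

definition covers :: "('a::field ^ 'r) set \<Rightarrow> ('a ^ 'r) set \<Rightarrow> ('a ^ 'r) set set" where
  "covers A W = {U. vec.subspace U \<and> vec.dim U = vec.dim A + 1 \<and> A \<subseteq> U \<and> U \<subseteq> W}"

text \<open>A vector \<open>v\<close> of \<open>W\<close> outside \<open>A\<close> lies in exactly
  one cover, the span of \<open>A\<close> and \<open>v\<close>. The set \<open>X\<close> is
  arbitrary, so the partition also counts the vectors of a single subspace.\<close>

lemma card_eq_sum_covers:
  fixes A W :: "('a::{field,finite} ^ 'r) set"
  assumes "vec.subspace A" "vec.subspace W" "A \<subseteq> W"
  shows "card (X \<inter> W - A) = (\<Sum>U\<in>covers A W. card (X \<inter> U - A))"
proof -
  have "X \<inter> W - A = (\<Union>U\<in>covers A W. X \<inter> U - A)"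
  proof (intro equalityI subsetI)
    fix v assume v: "v \<in> X \<inter> W - A"
    let ?U = "vec.span (insert v A)"
    have "?U \<subseteq> W" using v assms by (intro vec.span_minimal) auto
    moreover have "A \<subseteq> ?U" "v \<in> ?U" using vec.span_superset[of "insert v A"] by blast+
    ultimately have "?U \<in> covers A W"
      using vec_dim_insert[OF assms(1), of v] v by (auto simp: covers_def)
    then show "v \<in> (\<Union>U\<in>covers A W. X \<inter> U - A)" using v \<open>v \<in> ?U\<close> by blast
  next
    fix v assume "v \<in> (\<Union>U\<in>covers A W. X \<inter> U - A)"
    then show "v \<in> X \<inter> W - A" by (auto simp: covers_def)
  qed
  moreover have "(X \<inter> U - A) \<inter> (X \<inter> U' - A) = {}"
    if U: "U \<in> covers A W" and U': "U' \<in> covers A W" and ne: "U \<noteq> U'" for U U'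
  proof (rule ccontr)
    assume "(X \<inter> U - A) \<inter> (X \<inter> U' - A) \<noteq> {}"
    then obtain v where v: "v \<in> U" "v \<in> U'" "v \<notin> A" by blast
    have "vec.span (insert v A) = U" if "U \<in> covers A W" "v \<in> U" for U
    proof (rule subspace_eqI)
      show "vec.span (insert v A) \<subseteq> U"
        using that by (intro vec.span_minimal) (auto simp: covers_def)
    qed (use that vec_dim_insert[OF assms(1) v(3)] in \<open>auto simp: covers_def\<close>)
    then show False using U U' ne v by metis
  qed
  ultimately show ?thesis
    using card_UN_disjoint[of "covers A W" "\<lambda>U. X \<inter> U - A"] by simp
qed

text \<open>The sets \<open>U - A\<close> partition \<open>W - A\<close>, and each has
  \<open>q^(i+1) - q^i\<close> vectors, where \<open>i\<close> is the dimension of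
  \<open>A\<close>.\<close>

lemma card_covers:
  fixes A W :: "('a::{field,finite} ^ 'r) set"
  assumes A: "vec.subspace A" and W: "vec.subspace W" and "A \<subseteq> W"
  shows "int (card (covers A W)) = gauss_int CARD('a) (vec.dim W - vec.dim A)"
proof -
  let ?q = "int CARD('a)" and ?i = "vec.dim A" and ?d = "vec.dim W"
  have q: "?q \<ge> 2" using card_field_ge_2[where 'a='a] by linarith
  have le: "?i \<le> ?d" using assms vec.dim_subset by blast
  have diff: "int (card (U - A)) = ?q ^ vec.dim U - ?q ^ ?i" if "vec.subspace U" "A \<subseteq> U" for U
    using that A card_mono[of U A]
    by (simp add: card_Diff_subset card_vec_subspace of_nat_diff)
  have "?q ^ ?d - ?q ^ ?i = int (\<Sum>U\<in>covers A W. card (U - A))"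
    using card_eq_sum_covers[OF assms, of UNIV] diff[OF W] assms(3) by simp
  also have "\<dots> = (\<Sum>U\<in>covers A W. ?q ^ Suc ?i - ?q ^ ?i)"
    unfolding of_nat_sum by (intro sum.cong) (auto simp: covers_def diff)
  also have "\<dots> = ?q ^ ?i * ((?q - 1) * int (card (covers A W)))"
    by (simp add: algebra_simps)
  also have "?q ^ ?d - ?q ^ ?i = ?q ^ ?i * (?q ^ (?d - ?i) - 1)"
    using le by (simp add: algebra_simps flip: power_add)
  finally have "?q ^ (?d - ?i) - 1 = (?q - 1) * int (card (covers A W))"
    using q by simp
  then have "(?q - 1) * gauss_int CARD('a) (?d - ?i) = (?q - 1) * int (card (covers A W))"
    by (simp add: gauss_int_mult)
  then show ?thesis using q by simp
qed

text \<open>As \<open>E\<close> is not inside \<open>H\<close>, the sum \<open>E + H\<close> is the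
  whole space, and the dimension formula applies. The second claim makes the truncated subtraction
  in the first one exact.\<close>

lemma dim_Int_hyperplane:
  fixes E H :: "('a::field ^ 'r) set"
  assumes E: "vec.subspace E" and H: "hyperplane H" and "\<not> E \<subseteq> H"
  shows "vec.dim (E \<inter> H) = vec.dim E - 1" "vec.dim E \<ge> 1"
proof -
  have Hs: "vec.subspace H" and dH: "vec.dim H = CARD('r) - 1"
    using H by (auto simp: hyperplane_def)
  let ?S = "{x + y |x y. x \<in> E \<and> y \<in> H}"
  have "vec.dim ?S + vec.dim (E \<inter> H) = vec.dim E + vec.dim H"
    by (rule vec.dim_sums_Int[OF E Hs])
  moreover have "vec.dim ?S = CARD('r)"
  proof -
    have S: "vec.subspace ?S" by (rule vec.subspace_sums[OF E Hs])
    have "H \<subseteq> ?S" using vec.subspace_0[OF E] by force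
    moreover have "E \<subseteq> ?S" using vec.subspace_0[OF Hs] by force
    ultimately have "H \<subset> ?S" using assms(3) by blast
    then have "vec.dim H < vec.dim ?S" by (rule vec_dim_less[OF Hs S])
    moreover have "vec.dim ?S \<le> CARD('r)"
      using vec.dim_subset[of ?S UNIV] by (simp only: vec_dim_card subset_UNIV)
    ultimately show ?thesis using dH by simp
  qed
  moreover have "CARD('r) \<ge> 1" by (simp add: Suc_leI)
  ultimately show "vec.dim (E \<inter> H) = vec.dim E - 1" "vec.dim E \<ge> 1"
    using dH by linarith+
qed

section \<open>Counting flags\<close>

definition subspaces_of_dim :: "nat \<Rightarrow> ('a::field ^ 'r) set set" where
  "subspaces_of_dim h = {U. vec.subspace U \<and> vec.dim U = h}"

lemma num_contained_eq_sum_count: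
  fixes S :: "('a::{field,finite} ^ 'r) set multiset"
  assumes "set_mset S \<subseteq> \<U>"
  shows "num_contained S W = (\<Sum>U | U \<in> \<U> \<and> U \<subseteq> W. count S U)"
  unfolding num_contained_def size_multiset_overloaded_eq
  by (rule sum.mono_neutral_cong_left) (use assms in \<open>auto simp: not_in_iff\<close>)

text \<open>The last members of all chains of subspaces of dimensions \<open>0, 1, \<dots>, i\<close>.\<close>

primrec flag_ends :: "nat \<Rightarrow> ('a::{field,finite} ^ 'r) set multiset" where
  "flag_ends 0 = {#{0}#}"
| "flag_ends (Suc i) = (\<Sum>A\<in>#flag_ends i. mset_set (covers A UNIV))"

lemma set_flag_ends: "set_mset (flag_ends i) \<subseteq> (subspaces_of_dim i :: ('a::{field,finite} ^ 'r) set set)"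
  by (induction i) (auto simp: subspaces_of_dim_def vec.subspace_0 covers_def)

lemma num_contained_add: "num_contained (S + T) W = num_contained S W + num_contained T W"
  by (simp add: num_contained_def)

lemma num_contained_covers:
  fixes A W :: "('a::{field,finite} ^ 'r) set"
  assumes "vec.subspace A" "vec.subspace W"
  shows "int (num_contained (mset_set (covers A UNIV)) W) =
    (if A \<subseteq> W then gauss_int CARD('a) (vec.dim W - vec.dim A) else 0)"
proof -
  have "num_contained (mset_set (covers A UNIV)) W = card (covers A W)"
    by (auto simp: num_contained_def filter_mset_mset_set covers_def intro!: arg_cong[of _ _ card])
  moreover have "covers A W = {}" if "\<not> A \<subseteq> W" using that by (auto simp: covers_def)
  ultimately show ?thesis using assms by (simp add: card_covers)
qed

text \<open>A flag inside \<open>W\<close> ending in dimension \<open>j\<close> extends inside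
  \<open>W\<close> in \<open>[dim W - j]\<close> ways. If \<open>dim W < i\<close>, the factor at
  \<open>j = dim W\<close> is zero, as it should be.\<close>

lemma num_contained_flag_ends:
  fixes W :: "('a::{field,finite} ^ 'r) set"
  assumes W: "vec.subspace W"
  shows "int (num_contained (flag_ends i) W) = (\<Prod>j<i. gauss_int CARD('a) (vec.dim W - j))"
proof (induction i)
  case 0
  then show ?case using vec.subspace_0[OF W] by (simp add: num_contained_def)
next
  case (Suc i)
  have "int (num_contained (\<Sum>A\<in>#M. mset_set (covers A UNIV)) W) =
      int (num_contained M W) * gauss_int CARD('a) (vec.dim W - i)"
    if "set_mset M \<subseteq> subspaces_of_dim i" for M
    using that
  proof (induction M)
    case empty
    then show ?case by (simp add: num_contained_def)
  next
    case (add A M)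
    then show ?case
      using num_contained_covers[OF _ W, of A]
      by (simp add: num_contained_add subspaces_of_dim_def)
        (simp add: num_contained_def algebra_simps)
  qed
  from this[OF set_flag_ends] show ?case using Suc by simp
qed

lemma count_flag_ends:
  fixes U :: "('a::{field,finite} ^ 'r) set"
  assumes U: "U \<in> subspaces_of_dim h"
  shows "int (count (flag_ends h) U) = (\<Prod>j<h. gauss_int CARD('a) (h - j))"
proof -
  have "{#V \<in># flag_ends h. V \<subseteq> U#} = {#V \<in># flag_ends h. V = U#}"
  proof (rule filter_mset_cong)
    fix V :: "('a ^ 'r) set" assume "V \<in># flag_ends h"
    then have "V \<in> subspaces_of_dim h" using set_flag_ends by blast
    then show "V \<subseteq> U \<longleftrightarrow> V = U" using U subspace_eqI[of V U] by (auto simp: subspaces_of_dim_def)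
  qed simp
  then have "num_contained (flag_ends h) U = count (flag_ends h) U"
    by (simp add: num_contained_def filter_eq_replicate_mset)
  then show ?thesis
    using num_contained_flag_ends[of U h] U by (simp add: subspaces_of_dim_def)
qed

lemma count_flag_ends_pos:
  fixes U :: "('a::{field,finite} ^ 'r) set"
  assumes U: "U \<in> subspaces_of_dim h"
  shows "0 < count (flag_ends h) U"
proof -
  have "0 < int (count (flag_ends h) U)"
    unfolding count_flag_ends[OF U] by (intro prod_pos) (simp add: gauss_int_pos)
  then show ?thesis by simp
qed

text \<open>Double counting: the flags ending in dimension \<open>h\<close> inside \<open>B\<close>
  are spread evenly over the \<open>h\<close>-subspaces of \<open>B\<close>, and the two flag
  numbers have quotient \<open>[h + 1]\<close>.\<close>

lemma card_corank_one:
  fixes B :: "('a::{field,finite} ^ 'r) set"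
  assumes B: "B \<in> subspaces_of_dim (Suc h)"
  shows "int (card {U \<in> subspaces_of_dim h. U \<subseteq> B}) = gauss_int CARD('a) (Suc h)"
proof -
  let ?g = "gauss_int CARD('a)"
  have prod: "(\<Prod>j<h. ?g (h - j)) > 0" by (intro prod_pos) (simp add: gauss_int_pos)
  have split: "(\<Prod>j<Suc h. ?g (Suc h - j)) = ?g (Suc h) * (\<Prod>j<h. ?g (h - j))"
    by (subst prod.lessThan_Suc_shift) simp
  have "int (num_contained (flag_ends h) B) = (\<Prod>j<h. ?g (Suc h - j))"
    using B num_contained_flag_ends[of B h] by (simp add: subspaces_of_dim_def)
  \<comment> \<open>The additional factor, at \<open>j = h\<close>, is
    \<open>[1] = 1\<close>.\<close>
  also have "\<dots> = (\<Prod>j<Suc h. ?g (Suc h - j))"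
    by (simp add: gauss_int_Suc)
  finally have "int (num_contained (flag_ends h) B) = ?g (Suc h) * (\<Prod>j<h. ?g (h - j))"
    using split by simp
  moreover have "int (num_contained (flag_ends h) B) =
      int (card {U \<in> subspaces_of_dim h. U \<subseteq> B}) * (\<Prod>j<h. ?g (h - j))"
    using num_contained_eq_sum_count[OF set_flag_ends[of h], of B] by (simp add: count_flag_ends)
  ultimately have "int (card {U \<in> subspaces_of_dim h. U \<subseteq> B}) * (\<Prod>j<h. ?g (h - j)) =
      ?g (Suc h) * (\<Prod>j<h. ?g (h - j))"
    by (rule trans[OF sym, rotated])
  then show ?thesis
    by (rule mult_right_cancel[THEN iffD1, OF less_imp_neq[OF prod, symmetric]])
qed

section \<open>The Griesmer bound\<close>

text \<open>For subspaces, this is the size of the part inside \<open>W\<close> of the multiset of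
  points covered by \<open>S\<close>.\<close>

definition point_count :: "('a::{field,finite} ^ 'r) set multiset \<Rightarrow> ('a ^ 'r) set \<Rightarrow> int" where
  "point_count S W = (\<Sum>U\<in>#S. gauss_int CARD('a) (vec.dim (U \<inter> W)))"

lemma point_count_add_mset [simp]:
  fixes U :: "('a::{field,finite} ^ 'r) set"
  shows "point_count (add_mset U S) W = gauss_int CARD('a) (vec.dim (U \<inter> W)) + point_count S W"
  by (simp add: point_count_def)

text \<open>The covers of \<open>L\<close> partition the points of \<open>W\<close> outside
  \<open>L\<close>. The claim is additive in \<open>S\<close>, so one element \<open>U\<close> is
  treated at a time.\<close>

lemma point_count_covers:
  fixes L W :: "('a::{field,finite} ^ 'r) set"
  assumes L: "vec.subspace L" and W: "vec.subspace W" and "L \<subseteq> W"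
    and S: "\<forall>U\<in>#S. vec.subspace U"
  shows "point_count S W - point_count S L = (\<Sum>H\<in>covers L W. point_count S H - point_count S L)"
  using S
proof (induction S)
  case empty
  then show ?case by (simp add: point_count_def)
next
  case (add U S)
  let ?q = "int CARD('a)" and ?g = "\<lambda>X. gauss_int CARD('a) (vec.dim (U \<inter> X))"
  have q: "?q \<ge> 2" using card_field_ge_2[where 'a='a] by linarith
  have U: "vec.subspace U" using add.prems by simp
  \<comment> \<open>Passes from vectors to points: every point carries \<open>q - 1\<close> nonzero
    vectors.\<close>
  have diff: "int (card (U \<inter> X - L)) = (?q - 1) * (?g X - ?g L)"
    if "vec.subspace X" "L \<subseteq> X" for X
  proof -
    have "U \<inter> X - L = U \<inter> X - U \<inter> L" by blast
    moreover have "card (U \<inter> L) \<le> card (U \<inter> X)" using that by (intro card_mono) auto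
    moreover have "U \<inter> L \<subseteq> U \<inter> X" using that by blast
    ultimately have "int (card (U \<inter> X - L)) = int (card (U \<inter> X)) - int (card (U \<inter> L))"
      by (simp only: card_Diff_subset[OF finite] of_nat_diff)
    also have "\<dots> = (?q - 1) * (?g X - ?g L)"
      using U that L by (simp add: card_vec_subspace vec.subspace_inter right_diff_distrib gauss_int_mult)
    finally show ?thesis .
  qed
  have "(?q - 1) * (?g W - ?g L) = (\<Sum>H\<in>covers L W. int (card (U \<inter> H - L)))"
    unfolding diff[OF W assms(3), symmetric]
    by (simp add: card_eq_sum_covers[OF assms(1-3), of U])
  also have "\<dots> = (\<Sum>H\<in>covers L W. (?q - 1) * (?g H - ?g L))"
    by (intro sum.cong diff) (auto simp: covers_def)
  also have "\<dots> = (?q - 1) * (\<Sum>H\<in>covers L W. ?g H - ?g L)"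
    by (simp add: sum_distrib_left)
  finally have "?g W - ?g L = (\<Sum>H\<in>covers L W. ?g H - ?g L)"
    using q by simp
  then show ?case using add by (simp add: sum.distrib sum_subtractf algebra_simps)
qed

text \<open>Passing from \<open>W\<close> to a hyperplane \<open>H\<close> of \<open>W\<close> with the most points divides the
  minimum distance by at most \<open>q\<close>.\<close>

lemma griesmer_bound_points:
  fixes W :: "('a::{field,finite} ^ 'r) set"
  assumes S: "\<forall>U\<in>#S. vec.subspace U"
    and "vec.subspace W" "vec.dim W = d"
    and "\<And>H. vec.subspace H \<Longrightarrow> H \<subseteq> W \<Longrightarrow> vec.dim H + 1 = d \<Longrightarrow>
      D \<le> point_count S W - point_count S H"
  shows "griesmer_sum CARD('a) d D \<le> point_count S W"
  using assms(2-)
proof (induction d arbitrary: W D)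
  case 0
  have "0 \<le> point_count S W" by (induction S) (auto simp: point_count_def)
  then show ?case by (simp add: griesmer_sum_def)
next
  case (Suc d)
  let ?q = "CARD('a)"
  have q: "?q \<ge> 2" using card_field_ge_2[where 'a='a] .
  let ?Hs = "{H. vec.subspace H \<and> H \<subseteq> W \<and> vec.dim H = d}"
  have "?Hs \<noteq> {}"
    using subspace_of_dim_between[of "{0}" W d] Suc.prems vec.subspace_0[of W] by auto
  obtain H where H: "H \<in> ?Hs" and max: "\<forall>H'\<in>?Hs. point_count S H' \<le> point_count S H"
  proof -
    have "Max (point_count S ` ?Hs) \<in> point_count S ` ?Hs"
      using \<open>?Hs \<noteq> {}\<close> by (intro Max_in) auto
    then obtain H where "H \<in> ?Hs" "point_count S H = Max (point_count S ` ?Hs)" by auto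
    then show thesis by (intro that[of H]) auto
  qed
  define D0 where "D0 = point_count S W - point_count S H"
  have "D \<le> D0" unfolding D0_def using Suc.prems(3)[of H] H by auto
  have "griesmer_sum ?q d \<lceil>D / real ?q\<rceil> \<le> point_count S H"
  proof (rule Suc.IH)
    show "vec.subspace H" "vec.dim H = d" using H by auto
    fix L :: "('a ^ 'r) set" assume L: "vec.subspace L" "L \<subseteq> H" "vec.dim L + 1 = d"
    have "L \<subseteq> W" using L H by auto
    \<comment> \<open>\<open>L\<close> has codimension two in \<open>W\<close>, so it lies in
      \<open>q + 1\<close> hyperplanes of \<open>W\<close>, none with more points than
      \<open>H\<close>. Moving one of the \<open>q + 1\<close> terms to the other side leaves the
      factor \<open>q\<close>.\<close>
    have codim: "vec.dim W - vec.dim L = 2" using L(3) Suc.prems(2) by linarith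
    have "point_count S W - point_count S L = (\<Sum>H'\<in>covers L W. point_count S H' - point_count S L)"
      by (rule point_count_covers[OF L(1) Suc.prems(1) \<open>L \<subseteq> W\<close> S])
    also have "\<dots> \<le> (\<Sum>H'\<in>covers L W. point_count S H - point_count S L)"
      using max L(3) by (intro sum_mono) (auto simp: covers_def)
    also have "\<dots> = int (card (covers L W)) * (point_count S H - point_count S L)" by simp
    also have "int (card (covers L W)) = gauss_int ?q 2"
      using card_covers[OF L(1) Suc.prems(1) \<open>L \<subseteq> W\<close>] codim by simp
    also have "\<dots> = 1 + int ?q" by (simp add: gauss_int_def numeral_2_eq_2)
    finally have "D0 \<le> int ?q * (point_count S H - point_count S L)"
      by (simp add: D0_def algebra_simps)
    then have "D \<le> int ?q * (point_count S H - point_count S L)" using \<open>D \<le> D0\<close> by simp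
    then have "real_of_int D \<le> real ?q * real_of_int (point_count S H - point_count S L)"
      by (metis of_int_le_iff of_int_mult of_int_of_nat_eq)
    then show "\<lceil>D / real ?q\<rceil> \<le> point_count S H - point_count S L"
      using q by (simp add: ceiling_le_iff divide_le_eq mult.commute)
  qed
  \<comment> \<open>Rounding \<open>D / q\<close> up first can only increase the later
    terms.\<close>
  moreover have "griesmer_sum ?q (Suc d) D \<le> D + griesmer_sum ?q d \<lceil>D / real ?q\<rceil>"
  proof -
    have "(\<Sum>i<d. \<lceil>D / real ?q ^ Suc i\<rceil>) \<le> (\<Sum>i<d. \<lceil>\<lceil>D / real ?q\<rceil> / real ?q ^ i\<rceil>)"
      using q by (intro sum_mono ceiling_mono)
        (simp add: divide_right_mono flip: divide_divide_eq_left)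
    then show ?thesis
      unfolding griesmer_sum_def sum.lessThan_Suc_shift by (simp del: power_Suc)
  qed
  ultimately show ?case using \<open>D \<le> D0\<close> by (simp add: D0_def)
qed

lemma q_number_eq: "2 \<le> q \<Longrightarrow> q_number q h = real_of_int (gauss_int q h)"
proof -
  assume q: "2 \<le> q"
  have "real_of_int ((int q - 1) * gauss_int q h) = real_of_int (int q ^ h - 1)"
    by (simp only: gauss_int_mult)
  then show ?thesis using q by (simp add: q_number_def field_simps)
qed

text \<open>Enlarging the elements to dimension exactly \<open>h\<close> keeps the hyperplane bound.
  An element not inside a hyperplane then has \<open>q^(h-1)\<close> points off it, so the
  \<open>[h] * n\<close> covered points have minimum distance at least
  \<open>q^(h-1) * (n - s)\<close>.\<close>

lemma griesmer_condition_system: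
  fixes S :: "('a::{field,finite} ^ 'r::finite) set multiset"
  assumes "1 \<le> h" "h < CARD('r)" and S: "projective_system h n s S"
  shows "griesmer_condition CARD('a) CARD('r) h s (int n)"
proof -
  let ?g = "gauss_int CARD('a)"
  have "\<exists>E. vec.subspace E \<and> U \<subseteq> E \<and> vec.dim E = h" if "U \<in># S" for U
    using that S assms(2) subspace_of_dim_between[of U UNIV h] vec_dim_card[where 'a='a and 'n='r]
    by (metis less_imp_le projective_system_def subset_UNIV vec.subspace_UNIV)
  then obtain e where e: "\<And>U. U \<in># S \<Longrightarrow> vec.subspace (e U) \<and> U \<subseteq> e U \<and> vec.dim (e U) = h"
    by metis
  define T where "T = image_mset e S"
  have T: "\<forall>U\<in>#T. vec.subspace U \<and> vec.dim U = h" using e by (auto simp: T_def)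
  have size: "size T = n" using S by (simp add: T_def projective_system_def)
  have T_le: "num_contained T H \<le> s" if H: "hyperplane H" for H
  proof -
    have "num_contained T H = size {#U \<in># S. e U \<subseteq> H#}"
      by (simp add: num_contained_def T_def filter_mset_image_mset)
    also have "\<dots> \<le> num_contained S H"
      unfolding num_contained_def using e by (induction S) force+
    finally show ?thesis using S H by (auto simp: projective_system_def)
  qed
  have step: "point_count T UNIV - point_count T H = int CARD('a) ^ (h - 1) * (int (size T) - int (num_contained T H))"
    if H: "hyperplane H" for H
    using T
  proof (induction T)
    case empty
    then show ?case by (simp add: point_count_def num_contained_def)
  next
    case (add U T)
    have "?g h - ?g (vec.dim (U \<inter> H)) = (if U \<subseteq> H then 0 else int CARD('a) ^ (h - 1))"
    proof (cases "U \<subseteq> H")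
      case True
      then show ?thesis using add.prems by (simp add: Int_absorb2)
    next
      case False
      then have "vec.dim (U \<inter> H) = h - 1" using dim_Int_hyperplane(1)[of U H] H add.prems by simp
      then show ?thesis using False gauss_int_Suc[of _ "h - 1"] assms(1) by simp
    qed
    then show ?case using add by (simp add: num_contained_def algebra_simps split: if_splits)
  qed
  have "griesmer_sum CARD('a) CARD('r) (int CARD('a) ^ (h - 1) * (int n - int s)) \<le> point_count T UNIV"
  proof (rule griesmer_bound_points)
    show "vec.dim (UNIV :: ('a ^ 'r) set) = CARD('r)" by (rule vec_dim_card)
    fix H :: "('a ^ 'r) set" assume "vec.subspace H" "vec.dim H + 1 = CARD('r)"
    then have H: "hyperplane H" by (auto simp: hyperplane_def)
    show "int CARD('a) ^ (h - 1) * (int n - int s) \<le> point_count T UNIV - point_count T H"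
      unfolding step[OF H] size using T_le[OF H]
      by (intro mult_left_mono) auto
  qed (use T in auto)
  also have "point_count T UNIV = ?g h * int n"
    using T unfolding size[symmetric]
    by (induction T) (auto simp: point_count_def algebra_simps)
  finally have "real_of_int (griesmer_sum CARD('a) CARD('r) (int CARD('a) ^ (h - 1) * (int n - int s)))
      \<le> real_of_int (?g h * int n)"
    by (simp only: of_int_le_iff)
  then show ?thesis
    using card_field_ge_2[where 'a='a] by (simp add: griesmer_condition_def q_number_eq)
qed

section \<open>Signed weights on subspaces\<close>

text \<open>Summation by parts with \<open>[j + l + 1] = 1 + q * [j + l]\<close>. Below,
  \<open>l = 1\<close> serves the total weight and \<open>l = 0\<close> the hyperplanes through
  \<open>A\<close>.\<close>

lemma sum_telescope_gauss:
  fixes u :: "nat \<Rightarrow> int"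
  shows "(\<Sum>j<k. (int q * u (Suc j) - u j) * gauss_int q (j + l)) =
    gauss_int q (k + l) * u k - gauss_int q l * u 0 - (\<Sum>j<k. u (Suc j))"
proof (induction k)
  case (Suc k)
  have "gauss_int q (Suc k + l) = 1 + int q * gauss_int q (k + l)"
    using gauss_int_Suc'[of q "k + l"] by simp
  then show ?case using Suc by (simp add: algebra_simps)
qed simp

text \<open>
  With \<open>a j = q * u (j + 1) - u j \<ge> 0\<close>, the weights constructed below give a hyperplane \<open>H\<close> the weight
  \<open>s\<close> minus the sum of \<open>a j * q^j\<close> over all \<open>j\<close> with \<open>E j \<subseteq> H\<close>. The condition on the sum of the
  \<open>u (j + 1)\<close> is what cancels the contribution of the hyperplanes containing \<open>A\<close>.
\<close>

lemma exists_weights: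
  fixes u :: "nat \<Rightarrow> int" and s :: int and h k :: nat
  defines "\<U> \<equiv> subspaces_of_dim h :: ('a::{field,finite} ^ 'r::finite) set set"
  assumes h: "1 \<le> h" "1 \<le> k" "h + k = CARD('r)"
    and u: "\<And>j. j < k \<Longrightarrow> u j \<le> int CARD('a) * u (Suc j)"
    and sum_u: "(\<Sum>j<k. u (Suc j)) = gauss_int CARD('a) h * s"
  shows "\<exists>c. (\<Sum>U\<in>\<U>. c U) = s + u 0 \<and>
    (\<forall>H. hyperplane H \<longrightarrow> (\<Sum>U | U \<in> \<U> \<and> U \<subseteq> H. c U) \<le> s)"
proof -
  let ?q = "int CARD('a)" and ?g = "gauss_int CARD('a)"
  have UNIV: "vec.subspace (UNIV :: ('a ^ 'r) set)" "vec.dim (UNIV :: ('a ^ 'r) set) = h + k"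
    using vec_dim_card[where 'a='a and 'n='r] h(3) by auto
  have "\<exists>A :: ('a ^ 'r) set. vec.subspace A \<and> vec.dim A = h - 1"
    using subspace_of_dim_between[of "{0 :: 'a ^ 'r}" UNIV "h - 1"] UNIV trans_le_add1[OF diff_le_self, of h 1 k] by auto
  then obtain A :: "('a ^ 'r) set" where A: "vec.subspace A" "vec.dim A = h - 1" by blast
  have "\<exists>E. vec.subspace E \<and> A \<subseteq> E \<and> vec.dim E = h + j" if "j \<le> k" for j
    using subspace_of_dim_between[of A UNIV "h + j"] UNIV A that by auto
  then obtain E where E: "\<And>j. j \<le> k \<Longrightarrow> vec.subspace (E j) \<and> A \<subseteq> E j \<and> vec.dim (E j) = h + j"
    by metis
  define a where "a j = ?q * u (Suc j) - u j" for j
  \<comment> \<open>The first two terms give \<open>s - s * [h]\<close> to every hyperplane through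
    \<open>A\<close> and \<open>s\<close> to all others. The last two add \<open>s * [h]\<close>,
    minus the sum of \<open>a j * q^j\<close> over the \<open>E j\<close> inside it, to a hyperplane
    through \<open>A\<close>, and nothing to the others.\<close>
  define c where "c U = s * of_bool (U \<subseteq> E 1) - s * ?g h * of_bool (U \<in> covers A (E 1))
      - (\<Sum>j<k. a j * of_bool (U \<in> covers A (E j))) + u k * of_bool (U \<in> covers A UNIV)" for U
  define R where "R X W = int (card (covers A (X \<inter> W)))" for X W
  define N where "N W = int (card {U \<in> \<U>. U \<subseteq> E 1 \<inter> W})" for W
  have total: "(\<Sum>U | U \<in> \<U> \<and> U \<subseteq> W. c U) =
      s * N W - s * ?g h * R (E 1) W - (\<Sum>j<k. a j * R (E j) W) + u k * R UNIV W" for W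
  proof -
    have R: "(\<Sum>U | U \<in> \<U> \<and> U \<subseteq> W. of_bool (U \<in> covers A X)) = R X W" for X
    proof -
      have "{U. U \<in> \<U> \<and> U \<subseteq> W} \<inter> covers A X = covers A (X \<inter> W)"
        using A(2) h(1) by (auto simp: \<U>_def subspaces_of_dim_def covers_def)
      then show ?thesis by (simp add: R_def of_bool_def sum.If_cases)
    qed
    have N: "(\<Sum>U | U \<in> \<U> \<and> U \<subseteq> W. of_bool (U \<subseteq> E 1)) = N W"
    proof -
      have "{U. U \<in> \<U> \<and> U \<subseteq> W} \<inter> {U. U \<subseteq> E 1} = {U \<in> \<U>. U \<subseteq> E 1 \<inter> W}" by auto
      then show ?thesis by (simp add: N_def of_bool_def sum.If_cases)
    qed
    have swap: "(\<Sum>U | U \<in> \<U> \<and> U \<subseteq> W. \<Sum>j<k. a j * of_bool (U \<in> covers A (E j))) =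
        (\<Sum>j<k. a j * R (E j) W)"
      by (subst sum.swap) (simp only: R flip: sum_distrib_left)
    show ?thesis
      unfolding c_def sum.distrib sum_subtractf swap sum_distrib_left[symmetric] R N ..
  qed
  have telescope: "(\<Sum>j<k. a j * ?g (j + l)) = ?g (k + l) * u k - ?g l * u 0 - ?g h * s" for l
    unfolding a_def sum_telescope_gauss sum_u ..
  have R_inside: "R X W = ?g (Suc j)"
    if "vec.subspace X" "A \<subseteq> X" "vec.dim X = h + j" "X \<subseteq> W" for X W j
  proof -
    have "X \<inter> W = X" using that by blast
    then show ?thesis using card_covers[OF A(1) that(1,2)] that(3) A(2) h(1) by (simp add: R_def)
  qed
  have R_outside: "R X H = ?g j"
    if "vec.subspace X" "A \<subseteq> X" "vec.dim X = h + j" "hyperplane H" "\<not> X \<subseteq> H" "A \<subseteq> H" for X H j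
  proof -
    have "vec.subspace (X \<inter> H)" using that by (simp add: hyperplane_def vec.subspace_inter)
    then show ?thesis
      using card_covers[OF A(1), of "X \<inter> H"] dim_Int_hyperplane[OF that(1,4,5)] that A(2) h(1)
      by (simp add: R_def)
  qed
  have E1: "vec.subspace (E 1)" "A \<subseteq> E 1" "vec.dim (E 1) = Suc h" using E[of 1] h(2) by auto
  have N_inside: "N W = ?g (Suc h)" if "E 1 \<subseteq> W" for W
  proof -
    have "E 1 \<inter> W = E 1" using that by blast
    then show ?thesis using card_corank_one[of "E 1" h] E1 by (simp add: N_def \<U>_def subspaces_of_dim_def)
  qed
  \<comment> \<open>A hyperplane not containing \<open>E 1\<close> meets it in dimension
    \<open>h\<close>, so only the intersection itself is counted.\<close>
  have N_outside: "N H = 1" if H: "hyperplane H" and "\<not> E 1 \<subseteq> H" for H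
  proof -
    have dim: "vec.subspace (E 1 \<inter> H)" "vec.dim (E 1 \<inter> H) = h"
      using dim_Int_hyperplane[OF E1(1) that] E1 H by (auto simp: hyperplane_def vec.subspace_inter)
    then have "U = E 1 \<inter> H" if "U \<in> \<U>" "U \<subseteq> E 1 \<inter> H" for U
      using that by (intro subspace_eqI) (simp_all add: \<U>_def subspaces_of_dim_def)
    moreover have "E 1 \<inter> H \<in> \<U>" using dim by (simp add: \<U>_def subspaces_of_dim_def)
    ultimately have "{U \<in> \<U>. U \<subseteq> E 1 \<inter> H} = {E 1 \<inter> H}" by blast
    then show ?thesis by (simp add: N_def)
  qed
  have "(\<Sum>U\<in>\<U>. c U) = s + u 0"
  proof -
    have "(\<Sum>j<k. a j * R (E j) UNIV) = (\<Sum>j<k. a j * ?g (j + 1))"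
      by (intro sum.cong) (use E R_inside in auto)
    moreover have "R (E 1) UNIV = 1 + ?q" using R_inside[OF E1(1,2), of 1] E1(3) by (simp add: gauss_int_def)
    moreover have "R UNIV UNIV = ?g (k + 1)" using R_inside[OF UNIV(1) _ UNIV(2)] by simp
    moreover have "?g (Suc 0) = 1" by (simp add: gauss_int_def)
    ultimately show ?thesis
      using total[of UNIV] telescope[of 1] N_inside[of UNIV]
      by (simp add: gauss_int_Suc'[of _ h] algebra_simps)
  qed
  moreover have "(\<Sum>U | U \<in> \<U> \<and> U \<subseteq> H. c U) \<le> s" if H: "hyperplane H" for H
  proof (cases "A \<subseteq> H")
    case False
    then have "R X H = 0" for X
      by (auto simp: R_def covers_def)
    moreover have "N H = 1" using False E1 H by (intro N_outside) auto
    ultimately show ?thesis by (simp add: total)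
  next
    case True
    have "\<not> UNIV \<subseteq> H" using H UNIV h by (auto simp: hyperplane_def top.extremum_unique)
    then have RU: "R UNIV H = ?g k" using R_outside[OF UNIV(1) _ UNIV(2) H] True by simp
    have R: "R (E j) H = ?g j + ?q ^ j * of_bool (E j \<subseteq> H)" if "j \<le> k" for j
      using R_inside[of "E j" j H] R_outside[of "E j" j H] E[OF that] H True
      by (simp add: gauss_int_Suc)
    have R1: "R (E 1) H = 1 + ?q * of_bool (E 1 \<subseteq> H)"
      using R[of 1] h(2) by (simp add: gauss_int_def)
    have N1: "N H = 1 + ?q * ?g h * of_bool (E 1 \<subseteq> H)"
      using N_inside[of H] N_outside[OF H] by (simp add: gauss_int_Suc')
    have "(\<Sum>j<k. a j * R (E j) H) =
        (\<Sum>j<k. a j * ?g (j + 0)) + (\<Sum>j<k. a j * (?q ^ j * of_bool (E j \<subseteq> H)))"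
      unfolding sum.distrib[symmetric] by (intro sum.cong) (simp_all add: R distrib_left)
    then have "(\<Sum>U | U \<in> \<U> \<and> U \<subseteq> H. c U) = s - (\<Sum>j<k. a j * (?q ^ j * of_bool (E j \<subseteq> H)))"
      unfolding total RU R1 N1 telescope by (simp add: algebra_simps)
    moreover have "0 \<le> (\<Sum>j<k. a j * (?q ^ j * of_bool (E j \<subseteq> H)))"
      using u by (intro sum_nonneg mult_nonneg_nonneg) (auto simp: a_def)
    ultimately show ?thesis by simp
  qed
  ultimately show ?thesis by blast
qed

section \<open>From signed weights to multisets\<close>

text \<open>Every \<open>h\<close>-subspace occurs in \<open>flag_ends h\<close>, so adding
  \<open>m\<close> copies of it makes all multiplicities nonnegative once \<open>m\<close> reaches
  the sum of the \<open>\<bar>c U\<bar>\<close>.\<close>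

lemma exists_multiset_of_weights:
  fixes c :: "('a::{field,finite} ^ 'r::finite) set \<Rightarrow> int" and h :: nat
  defines "\<U> \<equiv> subspaces_of_dim h"
  assumes h: "h < CARD('r)"
  shows "\<forall>\<^sub>F m in sequentially. \<exists>S. set_mset S \<subseteq> \<U> \<and>
    (\<forall>W. vec.subspace W \<longrightarrow> int (num_contained S W) = int m * (\<Prod>j<h. gauss_int CARD('a) (vec.dim W - j))
       + (\<Sum>U | U \<in> \<U> \<and> U \<subseteq> W. c U))"
proof (rule eventually_sequentiallyI[of "nat (\<Sum>U\<in>\<U>. \<bar>c U\<bar>)"])
  fix m assume m: "nat (\<Sum>U\<in>\<U>. \<bar>c U\<bar>) \<le> m"
  define S where "S = (\<Sum>U\<in>\<U>. replicate_mset (nat (int m * int (count (flag_ends h) U) + c U)) U)"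
  have nonneg: "0 \<le> int m * int (count (flag_ends h) U) + c U" if U: "U \<in> \<U>" for U
  proof -
    have "- c U \<le> \<bar>c U\<bar>" by simp
    also have "\<dots> \<le> (\<Sum>U\<in>\<U>. \<bar>c U\<bar>)" using U by (intro member_le_sum) auto
    also have "\<dots> \<le> int m * 1" using m by linarith
    also have "\<dots> \<le> int m * int (count (flag_ends h) U)"
      using count_flag_ends_pos[of U h] U by (intro mult_left_mono) (auto simp: \<U>_def)
    finally show ?thesis by simp
  qed
  have count: "int (count S U) = int m * int (count (flag_ends h) U) + c U" if U: "U \<in> \<U>" for U
  proof -
    have "count S U = (\<Sum>V\<in>\<U>. if V = U then nat (int m * int (count (flag_ends h) U) + c U) else 0)"
      unfolding S_def count_sum by (intro sum.cong) auto
    then show ?thesis using U nonneg[OF U] by simp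
  qed
  have S: "set_mset S \<subseteq> \<U>"
    by (auto simp: S_def set_mset_sum split: if_splits)
  have "int (num_contained S W) = int m * (\<Prod>j<h. gauss_int CARD('a) (vec.dim W - j))
       + (\<Sum>U | U \<in> \<U> \<and> U \<subseteq> W. c U)" if W: "vec.subspace W" for W
  proof -
    have "int (num_contained S W) = (\<Sum>U | U \<in> \<U> \<and> U \<subseteq> W. int m * int (count (flag_ends h) U) + c U)"
      unfolding num_contained_eq_sum_count[OF S] of_nat_sum by (intro sum.cong) (auto simp: count)
    also have "\<dots> = int m * int (num_contained (flag_ends h) W) + (\<Sum>U | U \<in> \<U> \<and> U \<subseteq> W. c U)"
      by (simp add: num_contained_eq_sum_count[OF set_flag_ends] \<U>_def sum.distrib sum_distrib_left)
    finally show ?thesis by (simp add: num_contained_flag_ends[OF W])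
  qed
  then show "\<exists>S. set_mset S \<subseteq> \<U> \<and>
    (\<forall>W. vec.subspace W \<longrightarrow> int (num_contained S W) = int m * (\<Prod>j<h. gauss_int CARD('a) (vec.dim W - j))
       + (\<Sum>U | U \<in> \<U> \<and> U \<subseteq> W. c U))" using S by blast
qed

section \<open>The Griesmer condition for large \<open>s\<close>\<close>

text \<open>The terms of index \<open>h\<close> to \<open>h + k - 1\<close> of the Griesmer sum for
  \<open>q^(h-1) * t\<close>, the only ones where rounding can occur.\<close>

definition ceiling_sum :: "nat \<Rightarrow> nat \<Rightarrow> int \<Rightarrow> int" where
  "ceiling_sum q k t = (\<Sum>j<k. \<lceil>real_of_int t / real q ^ Suc j\<rceil>)"

text \<open>The first \<open>h\<close> quotients are the integers \<open>q^(h-1-i) * t\<close>, with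
  sum \<open>[h] * t\<close>; the next \<open>k\<close> reduce to
  \<open>t / q^(j+1)\<close>.\<close>

lemma griesmer_sum_eq:
  assumes "1 \<le> h" "2 \<le> q"
  shows "griesmer_sum q (h + k) (int q ^ (h - 1) * t) = gauss_int q h * t + ceiling_sum q k t"
proof (induction k)
  case 0
  have "\<lceil>real_of_int (int q ^ (h - 1) * t) / real q ^ i\<rceil> = int q ^ (h - Suc i) * t" if "i < h" for i
  proof -
    have "real q ^ (h - 1) = real q ^ (h - Suc i) * real q ^ i"
      using that by (simp flip: power_add)
    then have "real_of_int (int q ^ (h - 1) * t) / real q ^ i = real_of_int (int q ^ (h - Suc i) * t)"
      using assms(2) by simp
    then show ?thesis by (metis ceiling_of_int)
  qed
  then have "griesmer_sum q h (int q ^ (h - 1) * t) = (\<Sum>i<h. int q ^ (h - Suc i) * t)"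
    by (simp add: griesmer_sum_def)
  also have "\<dots> = gauss_int q h * t"
    by (simp add: gauss_int_def sum.nat_diff_reindex flip: sum_distrib_right)
  finally show ?case by (simp add: ceiling_sum_def)
next
  case (Suc k)
  have "real q ^ (h + k) = real q ^ (h - 1) * real q ^ Suc k"
    using assms(1) by (simp flip: power_add power_Suc)
  then have "real_of_int (int q ^ (h - 1) * t) / real q ^ (h + k) = real_of_int t / real q ^ Suc k"
    using assms(2) by simp
  then show ?case using Suc by (simp add: griesmer_sum_def ceiling_sum_def)
qed

lemma griesmer_condition_iff:
  assumes "1 \<le> h" "2 \<le> q"
  shows "griesmer_condition q (h + k) h s n \<longleftrightarrow>
    ceiling_sum q k (n - int s) \<le> gauss_int q h * int s"
proof -
  have "griesmer_condition q (h + k) h s n \<longleftrightarrow>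
      real_of_int (gauss_int q h * (n - int s) + ceiling_sum q k (n - int s)) \<le> real_of_int (gauss_int q h * n)"
    unfolding griesmer_condition_def griesmer_sum_eq[OF assms] q_number_eq[OF assms(2)] by simp
  also have "\<dots> \<longleftrightarrow> ceiling_sum q k (n - int s) \<le> gauss_int q h * int s"
    unfolding of_int_le_iff by (simp add: algebra_simps)
  finally show ?thesis .
qed

text \<open>All denominators divide \<open>q^k\<close>, so the shift leaves each ceiling as an
  integer. This periodicity reduces the theorem to finitely many pairs
  \<open>(s, t)\<close>.\<close>

lemma ceiling_sum_shift:
  assumes "0 < q"
  shows "ceiling_sum q k (t + int q ^ k * x) = ceiling_sum q k t + gauss_int q k * x"
proof -
  have "\<lceil>real_of_int (t + int q ^ k * x) / real q ^ Suc j\<rceil> =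
      \<lceil>real_of_int t / real q ^ Suc j\<rceil> + int q ^ (k - Suc j) * x" if "j < k" for j
  proof -
    have "real q ^ k = real q ^ (k - Suc j) * real q ^ Suc j"
      using that by (simp flip: power_add power_Suc)
    then have "real_of_int (t + int q ^ k * x) / real q ^ Suc j =
        real_of_int t / real q ^ Suc j + real_of_int (int q ^ (k - Suc j) * x)"
      using assms by (simp add: field_simps del: power_Suc)
    then show ?thesis by (metis ceiling_add_of_int)
  qed
  then have "ceiling_sum q k (t + int q ^ k * x) =
      ceiling_sum q k t + (\<Sum>j<k. int q ^ (k - Suc j) * x)"
    by (simp add: ceiling_sum_def sum.distrib)
  also have "(\<Sum>j<k. int q ^ (k - Suc j) * x) = gauss_int q k * x"
    by (simp add: gauss_int_def sum.nat_diff_reindex flip: sum_distrib_right)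
  finally show ?thesis .
qed

text \<open>The first term is at least \<open>t / q\<close> and the others are nonnegative. A bound
  on the ceiling sum thus bounds \<open>t\<close>.\<close>

lemma le_ceiling_sum:
  assumes "0 < q" "0 < k" "0 \<le> t"
  shows "t \<le> int q * ceiling_sum q k t"
proof -
  have "\<lceil>real_of_int t / real q ^ Suc 0\<rceil> \<le> ceiling_sum q k t"
    unfolding ceiling_sum_def using assms
    by (intro member_le_sum) (auto intro: order_trans[OF _ le_of_int_ceiling] simp: zero_le_ceiling
        less_le_trans[of _ 0])
  then have "real_of_int t / real q \<le> real_of_int (ceiling_sum q k t)"
    by (simp add: ceiling_le_iff)
  then have "real_of_int t \<le> real_of_int (int q * ceiling_sum q k t)"
    using assms by (simp add: field_simps)
  then show ?thesis by (simp only: of_int_le_iff)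
qed

section \<open>Systems attaining the Griesmer bound\<close>

lemma exists_weights_of_ceiling_sum:
  fixes s t :: int and h k :: nat
  defines "\<U> \<equiv> subspaces_of_dim h :: ('a::{field,finite} ^ 'r::finite) set set"
  assumes h: "1 \<le> h" "1 \<le> k" "h + k = CARD('r)"
    and le: "ceiling_sum CARD('a) k t \<le> gauss_int CARD('a) h * s"
  shows "\<exists>c. (\<Sum>U\<in>\<U>. c U) = s + t \<and>
    (\<forall>H. hyperplane H \<longrightarrow> (\<Sum>U | U \<in> \<U> \<and> U \<subseteq> H. c U) \<le> s)"
proof -
  let ?q = "CARD('a)"
  have q: "?q \<ge> 2" using card_field_ge_2[where 'a='a] .
  \<comment> \<open>Taking \<open>u j = \<lceil>t / q ^ j\<rceil>\<close> and putting all the slack into \<open>u k\<close> keeps \<open>u j \<le> q * u (j + 1)\<close>.\<close>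
  define \<delta> where "\<delta> = gauss_int ?q h * s - ceiling_sum ?q k t"
  define u where "u j = \<lceil>real_of_int t / real ?q ^ j\<rceil> + (if j = k then \<delta> else 0)" for j
  have "u j \<le> int ?q * u (Suc j)" if "j < k" for j
  proof -
    have "\<lceil>real_of_int t / real ?q ^ j\<rceil> \<le> int ?q * \<lceil>real_of_int t / real ?q ^ Suc j\<rceil>"
    proof (rule ceiling_le)
      have "real_of_int t / real ?q ^ j = real ?q * (real_of_int t / real ?q ^ Suc j)"
        using q by simp
      also have "\<dots> \<le> real ?q * real_of_int \<lceil>real_of_int t / real ?q ^ Suc j\<rceil>"
        by (intro mult_left_mono) auto
      finally show "real_of_int t / real ?q ^ j \<le>
          real_of_int (int ?q * \<lceil>real_of_int t / real ?q ^ Suc j\<rceil>)" by simp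
    qed
    moreover have "0 \<le> int ?q * \<delta>" using le by (simp add: \<delta>_def)
    ultimately show ?thesis using that by (auto simp: u_def distrib_left simp del: power_Suc)
  qed
  moreover have "(\<Sum>j<k. u (Suc j)) = gauss_int ?q h * s"
  proof -
    have "(\<Sum>j<k. if Suc j = k then \<delta> else 0) = (\<Sum>j<k. if j = k - 1 then \<delta> else 0)"
      using h(2) by (intro sum.cong) auto
    also have "\<dots> = \<delta>" using h(2) by simp
    finally show ?thesis
      by (simp add: u_def sum.distrib \<delta>_def ceiling_sum_def del: power_Suc)
  qed
  \<comment> \<open>As \<open>k\<close> \<ge> 1, index 0 does not receive the slack.\<close>
  moreover have "u 0 = t" using h(2) by (simp add: u_def)
  ultimately show ?thesis
    using exists_weights[where 'a='a and 'r='r, OF h, of u s] by (simp add: \<U>_def)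
qed

text \<open>The maximum \<open>\<mu>\<close> over the hyperplanes may be below \<open>s\<close>.
  Adding \<open>s - \<mu>\<close> copies of the zero subspace, which lies in every hyperplane,
  raises it to exactly \<open>s\<close> and does not shrink the system.\<close>

lemma le_max_system_size:
  fixes S :: "('a::{field,finite} ^ 'r::finite) set multiset"
  assumes h: "h < CARD('r)" and S: "set_mset S \<subseteq> subspaces_of_dim h"
    and le: "\<And>H. hyperplane H \<Longrightarrow> num_contained S H \<le> s"
  shows "size S \<le> max_system_size TYPE('a) TYPE('r) h s"
proof -
  let ?Hs = "{H :: ('a ^ 'r) set. hyperplane H}"
  define \<mu> where "\<mu> = Max (num_contained S ` ?Hs)"
  obtain H0 :: "('a ^ 'r) set" where "hyperplane H0"
    using subspace_in_hyperplane[of "{0 :: 'a ^ 'r}"] by (auto simp: vec.subspace_0)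
  then have "\<mu> \<in> num_contained S ` ?Hs" unfolding \<mu>_def by (intro Max_in) auto
  then obtain H1 where H1: "hyperplane H1" "num_contained S H1 = \<mu>" by auto
  have \<mu>: "num_contained S H \<le> \<mu>" if "hyperplane H" for H
    unfolding \<mu>_def using that by (intro Max_ge) auto
  have "\<mu> \<le> s" using le[OF H1(1)] H1(2) by simp
  define T where "T = S + replicate_mset (s - \<mu>) {0}"
  have T: "num_contained T H = num_contained S H + (s - \<mu>)" if "hyperplane H" for H
  proof -
    have "0 \<in> H" using that by (simp add: hyperplane_def vec.subspace_0)
    then have "num_contained (replicate_mset i {0}) H = i" for i
      by (induction i) (simp_all add: num_contained_def)
    then show ?thesis by (simp add: T_def num_contained_add)
  qed
  have "projective_system h (size T) s T"
    unfolding projective_system_def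
  proof (intro conjI allI impI)
    show "\<forall>U\<in>#T. vec.subspace U \<and> vec.dim U \<le> h"
      using S by (auto simp: T_def subspaces_of_dim_def split: if_splits)
    show "num_contained T H \<le> s" if "hyperplane H" for H
      using T[OF that] \<mu>[OF that] \<open>\<mu> \<le> s\<close> by simp
    show "\<exists>H. hyperplane H \<and> num_contained T H = s"
      using H1 T[OF H1(1)] \<open>\<mu> \<le> s\<close> by auto
  qed simp
  then have "size T \<le> max_system_size TYPE('a) TYPE('r) h s"
    unfolding max_system_size_def using system_sizes_finite[OF h] by (intro Max_ge) auto
  then show ?thesis by (simp add: T_def)
qed

lemma griesmer_condition_max_system_size:
  assumes "1 \<le> h" "h < CARD('r::finite)"
  shows "griesmer_condition CARD('a::{field,finite}) CARD('r) h s
    (int (max_system_size TYPE('a) TYPE('r) h s))"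
proof -
  have "max_system_size TYPE('a) TYPE('r) h s \<in>
      {n. \<exists>S :: ('a ^ 'r) set multiset. projective_system h n s S}"
    unfolding max_system_size_def
    by (rule Max_in[OF system_sizes_finite[OF assms(2)] system_sizes_nonempty])
  then show ?thesis using griesmer_condition_system[OF assms] by blast
qed

lemma eventually_exists_system:
  fixes s t :: int and h k :: nat
  assumes h: "1 \<le> h" "1 \<le> k" "h + k = CARD('r::finite)"
    and le: "ceiling_sum CARD('a::{field,finite}) k t \<le> gauss_int CARD('a) h * s"
  shows "\<forall>\<^sub>F m in sequentially. \<exists>S :: ('a ^ 'r) set multiset.
    set_mset S \<subseteq> subspaces_of_dim h \<and>
    int (size S) = int m * (\<Prod>j<h. gauss_int CARD('a) (h + k - j)) + s + t \<and>
    (\<forall>H. hyperplane H \<longrightarrow>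
      int (num_contained S H) \<le> int m * (\<Prod>j<h. gauss_int CARD('a) (h + k - Suc j)) + s)"
proof -
  let ?\<U> = "subspaces_of_dim h :: ('a ^ 'r) set set"
  obtain c where c: "(\<Sum>U\<in>?\<U>. c U) = s + t"
    "\<And>H. hyperplane H \<Longrightarrow> (\<Sum>U | U \<in> ?\<U> \<and> U \<subseteq> H. c U) \<le> s"
    using exists_weights_of_ceiling_sum[where 'a='a and 'r='r, OF h le] by blast
  have "h < CARD('r)" using h by simp
  from exists_multiset_of_weights[OF this, of c] show ?thesis
  proof (rule eventually_mono, elim exE conjE)
    fix m S
    assume S: "set_mset S \<subseteq> ?\<U>" and num: "\<forall>W. vec.subspace W \<longrightarrow> int (num_contained S W) =
      int m * (\<Prod>j<h. gauss_int CARD('a) (vec.dim W - j)) + (\<Sum>U | U \<in> ?\<U> \<and> U \<subseteq> W. c U)"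
    have "vec.dim (UNIV :: ('a ^ 'r) set) = h + k" using h(3) by (simp only: vec_dim_card)
    then have "int (num_contained S UNIV) = int m * (\<Prod>j<h. gauss_int CARD('a) (h + k - j)) + s + t"
      using num[rule_format, OF vec.subspace_UNIV] c(1) by simp
    moreover have "num_contained S UNIV = size S" by (simp add: num_contained_def)
    moreover have "int (num_contained S H) \<le> int m * (\<Prod>j<h. gauss_int CARD('a) (h + k - Suc j)) + s"
      if H: "hyperplane H" for H
    proof -
      have "vec.subspace H" "vec.dim H = h + k - 1" using H h(3) by (auto simp: hyperplane_def)
      then show ?thesis using num[rule_format, of H] c(2)[OF H] by simp
    qed
    ultimately show "\<exists>S. set_mset S \<subseteq> ?\<U> \<and>
      int (size S) = int m * (\<Prod>j<h. gauss_int CARD('a) (h + k - j)) + s + t \<and>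
      (\<forall>H. hyperplane H \<longrightarrow>
        int (num_contained S H) \<le> int m * (\<Prod>j<h. gauss_int CARD('a) (h + k - Suc j)) + s)"
      using S by auto
  qed
qed

theorem theorem4:
  fixes q r h :: nat
  assumes "CARD('a::{field,finite}) = q" and "CARD('r::finite) = r"
    and "1 \<le> h" and "h < r"
  shows "\<exists>s0. \<forall>s\<ge>s0.
    griesmer_condition q r h s (int (max_system_size TYPE('a) TYPE('r) h s)) \<and>
    (\<forall>n. griesmer_condition q r h s n \<longrightarrow> n \<le> int (max_system_size TYPE('a) TYPE('r) h s))"
proof -
  define k where "k = r - h"
  have k: "1 \<le> k" "h + k = CARD('r)" using assms by (auto simp: k_def)
  have q: "2 \<le> q" using card_field_ge_2[where 'a='a] assms(1) by simp
  let ?g = "gauss_int q"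
  \<comment> \<open>\<open>P0\<close> and \<open>P1\<close> count the flags in the whole space and
    in a hyperplane. Taking \<open>[k] * m\<close> copies of all flags shifts \<open>s\<close> by
    \<open>m * l\<close> and \<open>t\<close> by \<open>q^k * m * [h] * P1\<close>, so both sides of
    the condition grow by \<open>[h] * m * l\<close>.\<close>
  define P0 where "P0 = (\<Prod>j<h. ?g (h + k - j))"
  define P1 where "P1 = (\<Prod>j<h. ?g (h + k - Suc j))"
  define l where "l = ?g k * P1"
  have "P1 > 0" unfolding P1_def using k(1) by (intro prod_pos) (auto intro: gauss_int_pos)
  then have l: "l > 0" unfolding l_def using k(1) by (simp add: gauss_int_pos)
  \<comment> \<open>The product is split at its first factor here and at its last factor,
    \<open>[k]\<close>, below.\<close>
  have "(\<Prod>j<Suc h. ?g (h + k - j)) = ?g (h + k) * P1"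
    by (subst prod.lessThan_Suc_shift) (simp add: P1_def)
  then have "P0 * ?g k = ?g (h + k) * P1" by (simp add: P0_def)
  moreover have "?g (h + k) = ?g k + int q ^ k * ?g h" using gauss_int_add[of q k h] by (simp add: add.commute)
  ultimately have P0: "?g k * P0 = l + int q ^ k * (?g h * P1)" by (simp add: l_def algebra_simps)
  define good where "good m s t \<longleftrightarrow> (\<exists>S :: ('a ^ 'r) set multiset.
      set_mset S \<subseteq> subspaces_of_dim h \<and> int (size S) = m * P0 + s + t \<and>
      (\<forall>H. hyperplane H \<longrightarrow> int (num_contained S H) \<le> m * P1 + s))" for m s t
  \<comment> \<open>Representatives of the pairs \<open>(s, t)\<close> modulo the shift; the upper
    bound for \<open>t\<close> comes from \<open>le_ceiling_sum\<close>.\<close>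
  define B where "B = {(s, t) \<in> {0..<l} \<times> {0..int q * (?g h * l)}. ceiling_sum q k t \<le> ?g h * s}"
  have "finite B" unfolding B_def by (rule finite_subset[of _ "{0..<l} \<times> {0..int q * (?g h * l)}"]) auto
  then have "\<forall>\<^sub>F m in sequentially. \<forall>(s, t)\<in>B. good (int m) s t"
    using eventually_exists_system[where 'a='a and 'r='r, OF assms(3) k]
    by (intro eventually_ball_finite) (auto simp: B_def good_def P0_def P1_def assms(1))
  then obtain M where "\<forall>m\<ge>M. \<forall>(s, t)\<in>B. good (int m) s t"
    unfolding eventually_sequentially by blast
  then have M: "good (int m) s t" if "m \<ge> M" "(s, t) \<in> B" for m s t
    using that by blast
  have "n \<le> int (max_system_size TYPE('a) TYPE('r) h s)"
    if s: "s \<ge> M * nat l" and n: "griesmer_condition q r h s n" for s n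
  proof -
    define m where "m = s div nat l"
    define s' where "s' = int (s mod nat l)"
    define t' where "t' = n - int s - int q ^ k * (int m * (?g h * P1))"
    have s_eq: "int s = int m * l + s'"
    proof -
      have "int s = int (s div nat l * nat l + s mod nat l)" by simp
      then show ?thesis using l by (simp only: of_nat_add of_nat_mult m_def s'_def) simp
    qed
    have s': "0 \<le> s'" "s' < l" using l by (simp_all add: s'_def nat_less_iff flip: zless_nat_eq_int_zless)
    have "m \<ge> M" unfolding m_def using s l by (simp add: less_eq_div_iff_mult_less_eq)
    have "ceiling_sum q k (n - int s) = ceiling_sum q k t' + ?g k * (int m * (?g h * P1))"
      using ceiling_sum_shift[of q k t' "int m * (?g h * P1)"] q by (simp add: t'_def)
    moreover have "ceiling_sum q k (n - int s) \<le> ?g h * int s"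
      using n griesmer_condition_iff[OF assms(3) q] k(2) assms(2) by metis
    ultimately have t': "ceiling_sum q k t' \<le> ?g h * s'"
      by (simp add: s_eq l_def algebra_simps)
    \<comment> \<open>A negative \<open>t'\<close> is replaced by 0, where the condition is trivial;
      the resulting system is only larger than required.\<close>
    have "(s', max 0 t') \<in> B"
    proof (cases "0 \<le> t'")
      case True
      have "t' \<le> int q * ceiling_sum q k t'" using le_ceiling_sum[of q k t'] q k(1) True by simp
      also have "\<dots> \<le> int q * (?g h * l)"
        using t' s' by (intro mult_left_mono order_trans[OF t']) auto
      finally show ?thesis using True t' s' by (simp add: B_def)
    next
      case False
      have "0 \<le> int q * (?g h * l)" using l by simp
      then show ?thesis using False s' by (simp add: B_def ceiling_sum_def)
    qed
    \<comment> \<open>The flags are taken \<open>[k] * m\<close> times, so this number, not just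
      \<open>m\<close>, has to reach the threshold \<open>M\<close>.\<close>
    moreover have "?g k * int m \<ge> int M"
    proof -
      have "1 * int m \<le> ?g k * int m" using gauss_int_pos[of k q] k(1) by (intro mult_right_mono) auto
      then show ?thesis using \<open>m \<ge> M\<close> by simp
    qed
    ultimately have "good (int (nat (?g k * int m))) s' (max 0 t')"
      by (intro M) auto
    then have "good (?g k * int m) s' (max 0 t')" by simp
    then obtain S :: "('a ^ 'r) set multiset" where S: "set_mset S \<subseteq> subspaces_of_dim h"
      "int (size S) = ?g k * int m * P0 + s' + max 0 t'"
      "\<And>H. hyperplane H \<Longrightarrow> int (num_contained S H) \<le> ?g k * int m * P1 + s'"
      unfolding good_def by blast
    have "?g k * int m * P1 + s' = int s" by (simp add: s_eq l_def algebra_simps)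
    then have "num_contained S H \<le> s" if "hyperplane H" for H
      using S(3)[OF that] by simp
    then have "size S \<le> max_system_size TYPE('a) TYPE('r) h s"
      using S(1) assms by (intro le_max_system_size) auto
    moreover have "n \<le> int (size S)"
    proof -
      have "?g k * int m * P0 = int m * (?g k * P0)" by simp
      also have "\<dots> = int m * l + int q ^ k * (int m * (?g h * P1))"
        unfolding P0 by (simp add: algebra_simps)
      finally show ?thesis unfolding S(2) using s_eq by (simp add: t'_def)
    qed
    ultimately show ?thesis by simp
  qed
  then show ?thesis
    using griesmer_condition_max_system_size[where 'a='a and 'r='r, OF assms(3)] assms by blast
qed

end
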